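(* Let $N,M\ge 1$, let $\mathcal U=(\mathcal U_1,\dots,\mathcal U_N)$ and $\mathcal V=(\mathcal V_1,\dots,\mathcal V_M)$ be tuples of finite nonempty sets, and let $L$, $L_{\mathcal U}$, $L_{\mathcal V}$ be, respectively, the quantum logic of the $(\mathcal U,\mathcal V)$-box world and the quantum logics of the two single boxes. Let $\mathcal S(L)$, $\mathcal S(L_{\mathcal U})$, $\mathcal S(L_{\mathcal V})$ be the sets of all states on these logics. Then $L$, with state space $\mathcal S(L)$, is a strong tensor product of $L_{\mathcal U}$ and $L_{\mathcal V}$ (with state spaces $\mathcal S(L_{\mathcal U})$ and $\mathcal S(L_{\mathcal V})$).
   Context: **Quantum logics.** A quantum logic is a partially ordered set $L$ with a map $p\mapsto p^{\mathrm c}$, $L\to L$, such that: (L1) $L$ has a greatest element $\mathbb 1$ and a least element $0$; (L2) $p\le q$ implies $q^{\mathrm c}\le p^{\mathrm c}$; (L3) $(p^{\mathrm c})^{\mathrm c}=p$; (L4) for every countable family $\{p_i\}$ with $p_i\le p_j^{\mathrm c}$ for $i\ne j$, the supremum $\bigvee_i p_i$ exists; (L5) $p\le q$ implies $q=p\vee(q\wedge p^{\mathrm c})$. Elements $p,q$ are disjoint if $p\le q^{\mathrm c}$. A sublogic of $L$ is a subset closed under $p\mapsto p^{\mathrm c}$ and under suprema of countable families of pairwise disjoint elements. The sublogic generated by a subset is the smallest sublogic containing it. **States.** A state on $L$ is a map $\rho\colon L\to[0,1]$ with $\rho(\mathbb 1)=1$ and $\rho(\bigvee_i p_i)=\sum_i\rho(p_i)$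 for every countable family of pairwise disjoint elements. A set $\mathcal T$ of states on $L$ is rich if for all $a,b\in L$: $\{\mu\in\mathcal T : \mu(a)=1\}\subset\{\mu\in\mathcal T:\mu(b)=1\}$ implies $a\le b$. **Strong tensor product.** Let $L_1,L_2$ be quantum logics with state spaces $\mathcal S_1,\mathcal S_2$. A quantum logic $T$ with state space $\mathcal W$ is a strong tensor product of $L_1$ and $L_2$ if there are maps $\alpha\colon L_1\times L_2\to T$ and $\beta\colon\mathcal S_1\times\mathcal S_2\to\mathcal W$ such that (i) $\beta(\mu,\nu)(\alpha(a,b))=\mu(a)\nu(b)$ for all $\mu\in\mathcal S_1,\nu\in\mathcal S_2,a\in L_1,b\in L_2$; (ii) the set $\beta(\mathcal S_1\times\mathcal S_2)$ is rich for $T$; (iii) $T$ is generated by $\alpha(L_1\times L_2)$. **Box logics.** Here $\mathcal U_a$ ($a=1,\dots,N$) is the set of possible outcomes of the first box for input $a$, and $\mathcal V_b$ ($b=1,\dots,M$) the set of possible outcomes of the second box for input $b$. Let $\Gamma_1=\{(x_1,\dots,x_N): x_a\in\mathcal U_a\}$, $\Gamma_2=\{(y_1,\dots,y_M): y_b\in\mathcal V_b\}$, $\Gamma=\Gamma_1\times\Gamma_2$. The Boolean algebras $2^{\Gamma_1},2^{\Gamma_2},2^{\Gamma}$ are quantum logics under inclusion and set complement. - $L$, the logic of the $(\mathcal U,\mathcal V)$-box world, is the sublogic of $2^\Gamma$ (smallest family closed under complements and disjoint unions) generated by all sets $[a\alpha,b\beta]=\{(x,y)\in\Gamma: x_a=\alpha,\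 y_b=\beta\}$, with $1\le a\le N$, $\alpha\in\mathcal U_a$, $1\le b\le M$, $\beta\in\mathcal V_b$. - $L_{\mathcal U}$ is the sublogic of $2^{\Gamma_1}$ generated by all sets $[a\alpha]=\{x\in\Gamma_1:x_a=\alpha\}$, with $1\le a\le N$, $\alpha\in\mathcal U_a$. - $L_{\mathcal V}$ is the sublogic of $2^{\Gamma_2}$ generated by all sets $[b\beta]=\{y\in\Gamma_2:y_b=\beta\}$, with $1\le b\le M$, $\beta\in\mathcal V_b$. Each of these is ordered by inclusion with orthocomplement the set complement. *)

theory Defs
  imports "HOL-Algebra.Order" "HOL-Analysis.Infinite_Sum"
begin

section \<open>Quantum logics\<close>

record 'a qlogic = "'a gorder" +
  ortho :: "'a \<Rightarrow> 'a"

definition disjoint_elements :: "('a, 'm) qlogic_scheme \<Rightarrow> 'a \<Rightarrow> 'a \<Rightarrow> bool" where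
  "disjoint_elements L p q \<longleftrightarrow> p \<sqsubseteq>\<^bsub>L\<^esub> ortho L q"

text \<open>Countable families are indexed by arbitrary subsets of the natural numbers; this covers
  finite, empty and infinite families, possibly with repetitions.\<close>

definition pairwise_disjoint :: "('a, 'm) qlogic_scheme \<Rightarrow> nat set \<Rightarrow> (nat \<Rightarrow> 'a) \<Rightarrow> bool" where
  "pairwise_disjoint L I p \<longleftrightarrow>
     p \<in> I \<rightarrow> carrier L \<and> (\<forall>i\<in>I. \<forall>j\<in>I. i \<noteq> j \<longrightarrow> disjoint_elements L (p i) (p j))"

text \<open>In the last axiom the meet of \<open>q\<close> and the complement of \<open>p\<close> is asserted to exist;
  it does so already by the preceding axioms (De Morgan).\<close>

locale quantum_logic =
    partial_order L + weak_partial_order_bottom L + weak_partial_order_top L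
    for L :: "('a, 'm) qlogic_scheme" (structure) +
  assumes ortho_closed: "p \<in> carrier L \<Longrightarrow> ortho L p \<in> carrier L"
    and ortho_antimono:
      "\<lbrakk>p \<in> carrier L; q \<in> carrier L; p \<sqsubseteq> q\<rbrakk> \<Longrightarrow> ortho L q \<sqsubseteq> ortho L p"
    and ortho_ortho: "p \<in> carrier L \<Longrightarrow> ortho L (ortho L p) = p"
    and disjoint_lub_exists: "pairwise_disjoint L I f \<Longrightarrow> \<exists>s. is_lub L s (f ` I)"
    and orthomodular:
      "\<lbrakk>p \<in> carrier L; q \<in> carrier L; p \<sqsubseteq> q\<rbrakk>
        \<Longrightarrow> \<exists>r. is_glb L r {q, ortho L p} \<and> is_lub L q {p, r}"

definition sublogic :: "('a, 'm) qlogic_scheme \<Rightarrow> 'a set \<Rightarrow> bool" where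
  "sublogic L S \<longleftrightarrow>
     S \<subseteq> carrier L \<and>
     (\<forall>p\<in>S. ortho L p \<in> S) \<and>
     (\<forall>I p s. pairwise_disjoint L I p \<and> p ` I \<subseteq> S \<and> is_lub L s (p ` I) \<longrightarrow> s \<in> S)"

definition generated_sublogic :: "('a, 'm) qlogic_scheme \<Rightarrow> 'a set \<Rightarrow> 'a set" where
  "generated_sublogic L X = \<Inter> {S. sublogic L S \<and> X \<subseteq> S}"


section \<open>States\<close>

text \<open>States are extensional functions, so that they are determined by their values on the
  logic.\<close>

definition states :: "('a, 'm) qlogic_scheme \<Rightarrow> ('a \<Rightarrow> real) set" where
  "states L = {\<rho> \<in> carrier L \<rightarrow>\<^sub>E {0..1}.
     \<rho> \<top>\<^bsub>L\<^esub> = 1 \<and>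
     (\<forall>I p s. pairwise_disjoint L I p \<and> is_lub L s (p ` I) \<longrightarrow>
        ((\<lambda>i. \<rho> (p i)) has_sum \<rho> s) I)}"

definition rich :: "('a, 'm) qlogic_scheme \<Rightarrow> ('a \<Rightarrow> real) set \<Rightarrow> bool" where
  "rich L R \<longleftrightarrow>
     R \<subseteq> states L \<and>
     (\<forall>a\<in>carrier L. \<forall>b\<in>carrier L.
        {\<mu> \<in> R. \<mu> a = 1} \<subseteq> {\<mu> \<in> R. \<mu> b = 1} \<longrightarrow> a \<sqsubseteq>\<^bsub>L\<^esub> b)"


section \<open>Strong tensor products\<close>

definition strong_tensor_product ::
  "('t, 'm) qlogic_scheme \<Rightarrow> ('t \<Rightarrow> real) set \<Rightarrow>
   ('a, 'n) qlogic_scheme \<Rightarrow> ('a \<Rightarrow> real) set \<Rightarrow>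
   ('b, 'k) qlogic_scheme \<Rightarrow> ('b \<Rightarrow> real) set \<Rightarrow> bool" where
  "strong_tensor_product T W L\<^sub>1 S\<^sub>1 L\<^sub>2 S\<^sub>2 \<longleftrightarrow>
     quantum_logic L\<^sub>1 \<and> quantum_logic L\<^sub>2 \<and> quantum_logic T \<and>
     S\<^sub>1 \<subseteq> states L\<^sub>1 \<and> S\<^sub>2 \<subseteq> states L\<^sub>2 \<and> W \<subseteq> states T \<and>
     (\<exists>\<alpha> \<beta>.
        \<alpha> \<in> carrier L\<^sub>1 \<times> carrier L\<^sub>2 \<rightarrow> carrier T \<and>
        \<beta> \<in> S\<^sub>1 \<times> S\<^sub>2 \<rightarrow> W \<and>
        (\<forall>\<mu>\<in>S\<^sub>1. \<forall>\<nu>\<in>S\<^sub>2. \<forall>a\<in>carrier L\<^sub>1. \<forall>b\<in>carrier L\<^sub>2. \<beta> (\<mu>, \<nu>) (\<alpha> (a, b)) = \<mu> a * \<nu> b) \<and>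
        rich T (\<beta> ` (S\<^sub>1 \<times> S\<^sub>2)) \<and>
        generated_sublogic T (\<alpha> ` (carrier L\<^sub>1 \<times> carrier L\<^sub>2)) = carrier T)"


section \<open>Box logics\<close>

definition powerset_logic :: "'a set \<Rightarrow> 'a set qlogic" where
  "powerset_logic \<Gamma> = \<lparr>carrier = Pow \<Gamma>, eq = (=), le = (\<subseteq>), ortho = (\<lambda>A. \<Gamma> - A)\<rparr>"

definition generated_logic :: "'a set \<Rightarrow> 'a set set \<Rightarrow> 'a set qlogic" where
  "generated_logic \<Gamma> X =
     (powerset_logic \<Gamma>)\<lparr>carrier := generated_sublogic (powerset_logic \<Gamma>) X\<rparr>"

text \<open>The tuple of outcome sets of a box with inputs \<open>1, \<dots>, N\<close> is given by a function \<open>U\<close>, of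
  which only the values on \<open>{1..N}\<close> matter.\<close>

definition phase_space :: "nat \<Rightarrow> (nat \<Rightarrow> 'u set) \<Rightarrow> (nat \<Rightarrow> 'u) set" where
  "phase_space N U = (\<Pi>\<^sub>E a\<in>{1..N}. U a)"

definition single_box_logic :: "nat \<Rightarrow> (nat \<Rightarrow> 'u set) \<Rightarrow> (nat \<Rightarrow> 'u) set qlogic" where
  "single_box_logic N U =
     generated_logic (phase_space N U)
       {{x \<in> phase_space N U. x a = \<alpha>} | a \<alpha>. a \<in> {1..N} \<and> \<alpha> \<in> U a}"

definition box_world_logic ::
  "nat \<Rightarrow> (nat \<Rightarrow> 'u set) \<Rightarrow> nat \<Rightarrow> (nat \<Rightarrow> 'v set) \<Rightarrow> ((nat \<Rightarrow> 'u) \<times> (nat \<Rightarrow> 'v)) set qlogic" where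
  "box_world_logic N U M V =
     generated_logic (phase_space N U \<times> phase_space M V)
       {{(x, y) \<in> phase_space N U \<times> phase_space M V. x a = \<alpha> \<and> y b = \<beta>} | a \<alpha> b \<beta>.
          a \<in> {1..N} \<and> \<alpha> \<in> U a \<and> b \<in> {1..M} \<and> \<beta> \<in> V b}"

end

theory Submission
  imports Defs "HOL-Analysis.Sigma_Algebra"
begin

text \<open>Put \<open>\<alpha>(A, B) = A \<times> B\<close>. A state \<open>\<mu>\<close> of a single box gives a distribution of the outcomes for
  every input; the product of these distributions is a probability measure on the finite phase
  space, and it extends \<open>\<mu>\<close>, since it agrees with \<open>\<mu>\<close> on the generators. Let \<open>\<beta>(\<mu>, \<nu>)\<close> be the
  restriction to the box world logic of the product of the two measures extending \<open>\<mu>\<close> and \<open>\<nu>\<close>.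
  Point masses come from point masses, so these states are rich. The sublogics of a power set
  are exactly the Dynkin systems.\<close>

section \<open>Dynkin systems as quantum logics\<close>

text \<open>Covers the full power set and every generated logic by one construction, so that the
  order theory is done once for an arbitrary Dynkin system \<open>D\<close>.\<close>

definition set_logic :: "'a set \<Rightarrow> 'a set set \<Rightarrow> 'a set qlogic" where
  "set_logic \<Omega> D = (powerset_logic \<Omega>)\<lparr>carrier := D\<rparr>"

lemma set_logic_simps [simp]:
  "carrier (set_logic \<Omega> D) = D"
  "eq (set_logic \<Omega> D) = (=)"
  "le (set_logic \<Omega> D) = (\<subseteq>)"
  "ortho (set_logic \<Omega> D) = (\<lambda>A. \<Omega> - A)"
  by (simp_all add: set_logic_def powerset_logic_def)

lemma powerset_logic_eq: "powerset_logic \<Omega> = set_logic \<Omega> (Pow \<Omega>)"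
  by (simp add: set_logic_def powerset_logic_def)

text \<open>A family indexed by part of the naturals becomes a sequence when padded with empty sets,
  which keeps it disjoint.\<close>

lemma (in Dynkin_system) UN_countable:
  fixes p :: "nat \<Rightarrow> 'a set"
  assumes "p \<in> I \<rightarrow> M" and "disjoint_family_on p I"
  shows "\<Union> (p ` I) \<in> M"
proof -
  let ?q = "\<lambda>i. if i \<in> I then p i else {}"
  have "disjoint_family ?q"
    using assms(2) by (auto simp: disjoint_family_on_def)
  moreover have "range ?q \<subseteq> M"
    using assms(1) by auto
  ultimately have "(\<Union>i. ?q i) \<in> M"
    by (rule UN)
  also have "(\<Union>i. ?q i) = \<Union> (p ` I)"
    by (auto split: if_splits)
  finally show ?thesis .
qed

lemma (in Dynkin_system) UN_finite:
  assumes "finite J" and "\<And>j. j \<in> J \<Longrightarrow> A j \<in> M" and "disjoint_family_on A J"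
  shows "(\<Union>j\<in>J. A j) \<in> M"
proof -
  obtain h :: "nat \<Rightarrow> 'b" where h: "bij_betw h {0..<card J} J"
    using ex_bij_betw_nat_finite[OF assms(1)] by blast
  have im: "(A \<circ> h) ` {0..<card J} = A ` J"
    using bij_betw_imp_surj_on[OF h] by (metis image_comp)
  have "disjoint_family_on (A \<circ> h) {0..<card J}"
    using assms(3) h unfolding disjoint_family_on_def bij_betw_def inj_on_def by fastforce
  moreover have "A \<circ> h \<in> {0..<card J} \<rightarrow> M"
    using assms(2) bij_betwE[OF h] by auto
  ultimately have "\<Union> ((A \<circ> h) ` {0..<card J}) \<in> M"
    by (intro UN_countable)
  then show ?thesis
    by (simp only: im)
qed

lemma pairwise_disjoint_set_logic:
  assumes "D \<subseteq> Pow \<Omega>"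
  shows "pairwise_disjoint (set_logic \<Omega> D) I p \<longleftrightarrow> p \<in> I \<rightarrow> D \<and> disjoint_family_on p I"
  using assms
  by (fastforce simp: pairwise_disjoint_def disjoint_elements_def disjoint_family_on_def)

text \<open>Suprema inside \<open>D\<close> can in general be larger than unions; once the union
  belongs to \<open>D\<close>, it is an upper bound contained in all others.\<close>

lemma is_lub_set_logic:
  assumes "\<Union> P \<in> D" and "P \<subseteq> D"
  shows "is_lub (set_logic \<Omega> D) s P \<longleftrightarrow> s = \<Union> P"
  using assms by (auto simp: least_def Upper_def)

lemma is_lub_disjoint_set_logic:
  assumes "Dynkin_system \<Omega> D" and "pairwise_disjoint (set_logic \<Omega> D) I p"
  shows "is_lub (set_logic \<Omega> D) s (p ` I) \<longleftrightarrow> s = \<Union> (p ` I)"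
proof -
  interpret Dynkin_system \<Omega> D by fact
  have "p \<in> I \<rightarrow> D" and "disjoint_family_on p I"
    using assms(2) by (auto simp: pairwise_disjoint_set_logic[OF space_closed])
  then show ?thesis
    by (intro is_lub_set_logic UN_countable) auto
qed

lemma top_set_logic:
  assumes "Dynkin_system \<Omega> D"
  shows "\<top>\<^bsub>set_logic \<Omega> D\<^esub> = \<Omega>"
proof -
  interpret Dynkin_system \<Omega> D by fact
  have "greatest (set_logic \<Omega> D) x D \<longleftrightarrow> x = \<Omega>" for x
    using space sets_into_space by (auto simp: greatest_def)
  then show ?thesis
    by (simp add: top_def)
qed

lemma quantum_logic_set_logic:
  assumes "Dynkin_system \<Omega> D"
  shows "quantum_logic (set_logic \<Omega> D)"
proof -
  interpret Dynkin_system \<Omega> D by fact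
  show ?thesis
  proof
    show "\<exists>x. least (set_logic \<Omega> D) x (carrier (set_logic \<Omega> D))"
      by (rule exI[of _ "{}"]) (simp add: least_def)
    show "\<exists>x. greatest (set_logic \<Omega> D) x (carrier (set_logic \<Omega> D))"
      by (rule exI[of _ \<Omega>]) (use space sets_into_space in \<open>auto simp: greatest_def\<close>)
    show "\<exists>s. is_lub (set_logic \<Omega> D) s (f ` I)" if "pairwise_disjoint (set_logic \<Omega> D) I f" for I f
      using is_lub_disjoint_set_logic[OF assms that] by blast
    show "\<exists>r. is_glb (set_logic \<Omega> D) r {q, ortho (set_logic \<Omega> D) p} \<and> is_lub (set_logic \<Omega> D) q {p, r}"
      if "p \<in> carrier (set_logic \<Omega> D)" "q \<in> carrier (set_logic \<Omega> D)" "p \<sqsubseteq>\<^bsub>set_logic \<Omega> D\<^esub> q" for p q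
    \<comment> \<open>\<open>D\<close> need not be closed under intersections, but the meet
      \<open>q \<inter> (\<Omega> - p)\<close> is a difference of nested members, since
      \<open>p \<subseteq> q\<close>, and a Dynkin system contains those.\<close>
    proof (intro exI[of _ "q - p"] conjI)
      have "q - p \<in> D" and "\<Omega> - p \<in> D" and "q \<subseteq> \<Omega>"
        using that diff[of p q] sets_into_space by auto
      then show "is_glb (set_logic \<Omega> D) (q - p) {q, ortho (set_logic \<Omega> D) p}"
        using that by (auto simp: greatest_def Lower_def)
      have "p \<union> (q - p) = q"
        using that by auto
      then show "is_lub (set_logic \<Omega> D) q {p, q - p}"
        using that \<open>q - p \<in> D\<close> by (subst is_lub_set_logic) simp_all
    qed
  qed (use sets_into_space in auto)
qed

text \<open>Joins of disjoint families computed in \<open>D\<close> are unions, so closure under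
  them is the Dynkin condition on disjoint sequences.\<close>

lemma sublogic_set_logic:
  assumes "Dynkin_system \<Omega> D"
  shows "sublogic (set_logic \<Omega> D) S \<longleftrightarrow> S \<subseteq> D \<and> Dynkin_system \<Omega> S"
proof -
  interpret D: Dynkin_system \<Omega> D by fact
  note pd = pairwise_disjoint_set_logic[OF D.space_closed]
  show ?thesis
  proof safe
    assume S: "sublogic (set_logic \<Omega> D) S"
    have closed: "\<Union> (p ` I) \<in> S" if "p ` I \<subseteq> S" "disjoint_family_on p I" for p :: "nat \<Rightarrow> _" and I
    proof -
      have "pairwise_disjoint (set_logic \<Omega> D) I p"
        unfolding pd using that S by (auto simp: sublogic_def)
      then show ?thesis
        using S that is_lub_disjoint_set_logic[OF assms] unfolding sublogic_def by blast
    qed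
    show "Dynkin_system \<Omega> S"
    proof (rule Dynkin_systemI')
      \<comment> \<open>The bottom element comes from the empty index set, as the definition of a
        sublogic does not list it.\<close>
      show "{} \<in> S"
        using closed[of "\<lambda>_. {}" "{}"] by (simp add: disjoint_family_on_def)
      show "A \<subseteq> \<Omega>" if "A \<in> S" for A
        using that S D.sets_into_space by (auto simp: sublogic_def)
      show "\<Omega> - A \<in> S" if "A \<in> S" for A
        using that S by (simp add: sublogic_def)
    qed (use closed in auto)
  next
    fix A assume "sublogic (set_logic \<Omega> D) S" "A \<in> S"
    then show "A \<in> D"
      by (auto simp: sublogic_def)
  next
    assume S: "S \<subseteq> D" "Dynkin_system \<Omega> S"
    interpret S: Dynkin_system \<Omega> S by fact
    have "s \<in> S" if "pairwise_disjoint (set_logic \<Omega> D) I p" "p ` I \<subseteq> S"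
      "is_lub (set_logic \<Omega> D) s (p ` I)" for I p s
    proof -
      have "\<Union> (p ` I) \<in> S"
        using that by (intro S.UN_countable) (auto simp: pd)
      then show ?thesis
        using that(3) by (simp add: is_lub_disjoint_set_logic[OF assms that(1)])
    qed
    then show "sublogic (set_logic \<Omega> D) S"
      using S by (auto simp: sublogic_def)
  qed
qed

text \<open>The Dynkin hull of \<open>X\<close> lies in \<open>D\<close>, hence is itself one of the
  sublogics being intersected, and it is contained in each of the others.\<close>

lemma generated_sublogic_set_logic:
  assumes "Dynkin_system \<Omega> D" and "X \<subseteq> D"
  shows "generated_sublogic (set_logic \<Omega> D) X = Dynkin \<Omega> X"
proof -
  interpret Dynkin_system \<Omega> D by fact
  have "Dynkin \<Omega> X \<subseteq> D"
    by (rule Dynkin_subset) fact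
  moreover have "Dynkin_system \<Omega> (Dynkin \<Omega> X)"
    using assms(2) space_closed by (intro Dynkin_system_Dynkin) auto
  moreover have "X \<subseteq> Dynkin \<Omega> X"
    by auto
  ultimately have "Dynkin \<Omega> X \<in> {S. (S \<subseteq> D \<and> Dynkin_system \<Omega> S) \<and> X \<subseteq> S}"
    by blast
  then show ?thesis
    unfolding generated_sublogic_def sublogic_set_logic[OF assms(1)]
    by (intro equalityI Inter_lower Inter_greatest) (auto simp: Dynkin_def)
qed

lemma generated_logic_eq:
  assumes "X \<subseteq> Pow \<Omega>"
  shows "generated_logic \<Omega> X = set_logic \<Omega> (Dynkin \<Omega> X)"
  unfolding generated_logic_def powerset_logic_eq
    generated_sublogic_set_logic[OF Dynkin_system_trivial assms]
  by (simp add: set_logic_def)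

section \<open>Preimages and rectangles in Dynkin systems\<close>

text \<open>A good-sets argument: the sets whose preimage lies in \<open>D\<close> form a Dynkin
  system containing \<open>X\<close>. The domain \<open>E\<close> may be a proper subset of
  \<open>\<Omega>\<close>, so complements are taken relative to \<open>E\<close>, and the finite
  partition \<open>C\<close> into generators serves to place \<open>E\<close> in
  \<open>D\<close>.\<close>

lemma vimage_in_Dynkin_system:
  assumes D: "Dynkin_system \<Omega> D" and g: "g \<in> E \<rightarrow> \<Omega>'" and X: "X \<subseteq> Pow \<Omega>'"
    and gen: "\<And>a. a \<in> X \<Longrightarrow> g -` a \<inter> E \<in> D"
    and C: "C \<subseteq> X" "finite C" "disjoint C" "\<Union> C = \<Omega>'"
    and A: "A \<in> Dynkin \<Omega>' X"
  shows "g -` A \<inter> E \<in> D"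
proof -
  interpret Dynkin_system \<Omega> D by fact
  have "(\<Union>c\<in>C. g -` c \<inter> E) \<in> D"
    using C gen by (intro UN_finite) (auto simp: disjoint_family_on_def disjoint_def)
  also have "(\<Union>c\<in>C. g -` c \<inter> E) = E"
    using C(4) g by auto
  finally have E: "E \<in> D" .
  let ?S = "{A \<in> Pow \<Omega>'. g -` A \<inter> E \<in> D}"
  interpret S: Dynkin_system \<Omega>' ?S
  proof (rule Dynkin_systemI')
    fix A assume "A \<in> ?S"
    moreover have "g -` (\<Omega>' - A) \<inter> E = E - (g -` A \<inter> E)"
      using g by auto
    ultimately show "\<Omega>' - A \<in> ?S"
      using E by (auto intro!: diff)
  next
    fix A :: "nat \<Rightarrow> _" assume A: "disjoint_family A" "range A \<subseteq> ?S"
    have "(\<Union>i. g -` A i \<inter> E) \<in> D"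
      using A by (intro UN) (auto simp: disjoint_family_on_def)
    also have "(\<Union>i. g -` A i \<inter> E) = g -` (\<Union>i. A i) \<inter> E"
      by auto
    finally show "(\<Union>i. A i) \<in> ?S"
      using A by auto
  qed auto
  have "Dynkin \<Omega>' X \<subseteq> ?S"
    using X gen by (intro S.Dynkin_subset) auto
  then show ?thesis
    using A by auto
qed

text \<open>One factor is extended at a time. First \<open>b\<close> stays a generator while the
  other side grows to \<open>A\<close>, by the projection \<open>fst\<close> on
  \<open>\<Omega>1 \<times> b\<close>; then \<open>A\<close> is held fixed and \<open>b\<close>
  grows to \<open>B\<close>, by \<open>snd\<close> on \<open>A \<times> \<Omega>2\<close>.\<close>

lemma Times_in_Dynkin_system:
  assumes D: "Dynkin_system (\<Omega>1 \<times> \<Omega>2) D"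
    and X: "X \<subseteq> Pow \<Omega>1" and C: "C \<subseteq> X" "finite C" "disjoint C" "\<Union> C = \<Omega>1"
    and Y: "Y \<subseteq> Pow \<Omega>2" and C': "C' \<subseteq> Y" "finite C'" "disjoint C'" "\<Union> C' = \<Omega>2"
    and gen: "\<And>a b. a \<in> X \<Longrightarrow> b \<in> Y \<Longrightarrow> a \<times> b \<in> D"
    and A: "A \<in> Dynkin \<Omega>1 X" and B: "B \<in> Dynkin \<Omega>2 Y"
  shows "A \<times> B \<in> D"
proof -
  have fst_eq: "fst -` a \<inter> \<Omega>1 \<times> b = a \<times> b" if "a \<subseteq> \<Omega>1" for a and b :: "'b set"
    using that by auto
  have snd_eq: "snd -` b \<inter> a \<times> \<Omega>2 = a \<times> b" if "b \<subseteq> \<Omega>2" for b and a :: "'a set"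
    using that by auto
  have "A \<subseteq> \<Omega>1" "B \<subseteq> \<Omega>2"
    using A B Dynkin_system_Dynkin[of X \<Omega>1] Dynkin_system_Dynkin[of Y \<Omega>2] X Y
    by (auto simp: Dynkin_system_def subset_class_def)
  have 1: "A \<times> b \<in> D" if "b \<in> Y" for b
  proof -
    have "fst -` A \<inter> \<Omega>1 \<times> b \<in> D"
    proof (rule vimage_in_Dynkin_system[OF D _ X _ C A])
      show "fst -` a \<inter> \<Omega>1 \<times> b \<in> D" if "a \<in> X" for a
        using X gen[OF that \<open>b \<in> Y\<close>] that by (subst fst_eq) auto
    qed auto
    then show ?thesis
      using \<open>A \<subseteq> \<Omega>1\<close> by (simp add: fst_eq)
  qed
  have "snd -` B \<inter> A \<times> \<Omega>2 \<in> D"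
  proof (rule vimage_in_Dynkin_system[OF D _ Y _ C' B])
    show "snd -` b \<inter> A \<times> \<Omega>2 \<in> D" if "b \<in> Y" for b
      using Y 1[OF that] that by (subst snd_eq) auto
  qed auto
  then show ?thesis
    using \<open>B \<subseteq> \<Omega>2\<close> by (simp add: snd_eq)
qed

section \<open>States given by weights\<close>

lemma states_set_logic:
  assumes "Dynkin_system \<Omega> D"
  shows "\<rho> \<in> states (set_logic \<Omega> D) \<longleftrightarrow> \<rho> \<in> D \<rightarrow>\<^sub>E {0..1} \<and> \<rho> \<Omega> = 1 \<and>
    (\<forall>I p. p \<in> I \<rightarrow> D \<and> disjoint_family_on p I \<longrightarrow>
      ((\<lambda>i. \<rho> (p i)) has_sum \<rho> (\<Union> (p ` I))) (I :: nat set))"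
proof -
  interpret Dynkin_system \<Omega> D by fact
  show ?thesis
    unfolding states_def top_set_logic[OF assms] set_logic_simps mem_Collect_eq
      pairwise_disjoint_set_logic[OF space_closed, symmetric]
    by (simp add: is_lub_disjoint_set_logic[OF assms] cong: conj_cong)
qed

lemma state_UN_finite:
  assumes "Dynkin_system \<Omega> D" and "\<rho> \<in> states (set_logic \<Omega> D)"
    and "finite J" and "\<And>j. j \<in> J \<Longrightarrow> A j \<in> D" and "disjoint_family_on A J"
  shows "\<rho> (\<Union>j\<in>J. A j) = (\<Sum>j\<in>J. \<rho> (A j))"
proof -
  obtain h :: "nat \<Rightarrow> 'b" where h: "bij_betw h {0..<card J} J"
    using ex_bij_betw_nat_finite[OF assms(3)] by blast
  have im: "(A \<circ> h) ` {0..<card J} = A ` J"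
    using bij_betw_imp_surj_on[OF h] by (metis image_comp)
  let ?I = "{0..<card J}"
  have "disjoint_family_on (A \<circ> h) ?I"
    using assms(5) h unfolding disjoint_family_on_def bij_betw_def inj_on_def by fastforce
  moreover have "A \<circ> h \<in> ?I \<rightarrow> D"
    using assms(4) bij_betwE[OF h] by auto
  ultimately have "((\<lambda>i. \<rho> ((A \<circ> h) i)) has_sum \<rho> (\<Union> ((A \<circ> h) ` ?I))) ?I"
    using assms(2) unfolding states_set_logic[OF assms(1)] by blast
  then have "\<rho> (\<Union> ((A \<circ> h) ` ?I)) = (\<Sum>i\<in>?I. \<rho> (A (h i)))"
    by (simp add: has_sum_finite_iff)
  also have "\<dots> = (\<Sum>j\<in>J. \<rho> (A j))"
    using h by (rule sum.reindex_bij_betw)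
  finally show ?thesis
    by (simp only: im)
qed

lemma state_compl:
  assumes D: "Dynkin_system \<Omega> D" and \<rho>: "\<rho> \<in> states (set_logic \<Omega> D)" and A: "A \<in> D"
  shows "\<rho> (\<Omega> - A) = 1 - \<rho> A"
proof -
  interpret Dynkin_system \<Omega> D by fact
  \<comment> \<open>The two-member family \<open>A\<close>, \<open>\<Omega> - A\<close> is indexed
    by the booleans to fit finite additivity.\<close>
  have "\<rho> (\<Union>b\<in>{True, False}. if b then A else \<Omega> - A)
      = (\<Sum>b\<in>{True, False}. \<rho> (if b then A else \<Omega> - A))"
    by (rule state_UN_finite[OF D \<rho>]) (use A in \<open>auto simp: disjoint_family_on_def\<close>)
  moreover have "\<Omega> \<union> A = \<Omega>"
    using sets_into_space[OF A] by auto
  moreover have "\<rho> \<Omega> = 1"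
    using \<rho> by (simp add: states_set_logic[OF D])
  ultimately show ?thesis
    by (simp add: Un_commute)
qed

section \<open>Weights on a finite set\<close>

text \<open>On a finite set a disjoint family has only finitely many nonempty members, because it is
  injective on their indices and takes values in a finite power set. The infinite sum therefore
  reduces to a finite one.\<close>

lemma has_sum_weight:
  fixes w :: "'a \<Rightarrow> real" and p :: "nat \<Rightarrow> 'a set"
  assumes "finite \<Omega>" and "\<And>i. i \<in> I \<Longrightarrow> p i \<subseteq> \<Omega>" and "disjoint_family_on p I"
  shows "((\<lambda>i. sum w (p i)) has_sum sum w (\<Union> (p ` I))) I"
proof -
  let ?J = "{i \<in> I. p i \<noteq> {}}"
  have "inj_on p ?J"
    using assms(3) unfolding inj_on_def disjoint_family_on_def by auto
  moreover have "finite (p ` ?J)"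
    using assms(1,2) by (intro finite_subset[of "p ` ?J" "Pow \<Omega>"]) auto
  ultimately have "finite ?J"
    using finite_imageD by blast
  then show ?thesis
  proof (rule has_sum_finite_neutralI)
    have "sum w (\<Union> (p ` ?J)) = (\<Sum>i\<in>?J. sum w (p i))"
      using \<open>finite ?J\<close> assms finite_subset[OF assms(2) assms(1)]
      by (intro sum.UNION_disjoint) (auto simp: disjoint_family_on_def)
    also have "\<Union> (p ` ?J) = \<Union> (p ` I)"
      by auto
    finally show "sum w (\<Union> (p ` I)) = (\<Sum>i\<in>?J. sum w (p i))" .
  qed auto
qed

text \<open>For a probability mass function \<open>w\<close> this is the corresponding measure cut
  down to \<open>D\<close>; the bounded lambda is there because states are extensional.\<close>

definition weight_state :: "'a set set \<Rightarrow> ('a \<Rightarrow> real) \<Rightarrow> 'a set \<Rightarrow> real" where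
  "weight_state D w = (\<lambda>A\<in>D. sum w A)"

lemma weight_state_in_states:
  assumes "finite \<Omega>" and D: "Dynkin_system \<Omega> D"
    and nonneg: "\<And>z. z \<in> \<Omega> \<Longrightarrow> 0 \<le> w z" and total: "sum w \<Omega> = 1"
  shows "weight_state D w \<in> states (set_logic \<Omega> D)"
proof -
  interpret Dynkin_system \<Omega> D by fact
  have "sum w A \<in> {0..1}" if "A \<in> D" for A
  proof -
    have "0 \<le> sum w A" "sum w A \<le> sum w \<Omega>"
      using sets_into_space[OF that] nonneg assms(1) by (auto intro!: sum_nonneg sum_mono2)
    then show ?thesis
      using total by simp
  qed
  moreover have "((\<lambda>i. weight_state D w (p i)) has_sum weight_state D w (\<Union> (p ` I))) I"
    if p: "p \<in> I \<rightarrow> D" "disjoint_family_on p I" for p and I :: "nat set"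
  proof -
    have "p i \<subseteq> \<Omega>" if "i \<in> I" for i
      using p(1) that sets_into_space by auto
    then have "((\<lambda>i. sum w (p i)) has_sum sum w (\<Union> (p ` I))) I"
      using p assms(1) by (intro has_sum_weight)
    moreover have "((\<lambda>i. weight_state D w (p i)) has_sum s) I \<longleftrightarrow> ((\<lambda>i. sum w (p i)) has_sum s) I" for s
      using p(1) by (intro has_sum_cong) (auto simp: weight_state_def)
    ultimately show ?thesis
      using UN_countable[OF p] by (simp add: weight_state_def)
  qed
  ultimately show ?thesis
    unfolding states_set_logic[OF D] using total space by (auto simp: weight_state_def)
qed

text \<open>The members of the logic on which the weight and the state agree form a Dynkin system,
  so agreement on the generators spreads to the whole Dynkin hull.\<close>

lemma state_eq_weight:
  assumes "finite \<Omega>" and X: "X \<subseteq> Pow \<Omega>"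
    and \<rho>: "\<rho> \<in> states (set_logic \<Omega> (Dynkin \<Omega> X))"
    and total: "sum w \<Omega> = 1" and gen: "\<And>a. a \<in> X \<Longrightarrow> sum w a = \<rho> a"
    and A: "A \<in> Dynkin \<Omega> X"
  shows "sum w A = \<rho> A"
proof -
  let ?D = "Dynkin \<Omega> X" and ?S = "{A \<in> Dynkin \<Omega> X. sum w A = \<rho> A}"
  note D = Dynkin_system_Dynkin[OF X]
  interpret Dynkin_system \<Omega> ?D by (rule D)
  \<comment> \<open>Both sides are the sum of the same series, by additivity of
    \<open>\<rho>\<close> and of the weight, and sums are unique.\<close>
  have sum_UN: "\<rho> (\<Union> (p ` I)) = sum w (\<Union> (p ` I))"
    if p: "p ` I \<subseteq> ?S" "disjoint_family_on p I" for p and I :: "nat set"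
  proof -
    have "((\<lambda>i. \<rho> (p i)) has_sum \<rho> (\<Union> (p ` I))) I"
      using p \<rho> unfolding states_set_logic[OF D] by blast
    moreover have "((\<lambda>i. \<rho> (p i)) has_sum s) I \<longleftrightarrow> ((\<lambda>i. sum w (p i)) has_sum s) I" for s
      using p(1) by (intro has_sum_cong) auto
    moreover have "((\<lambda>i. sum w (p i)) has_sum sum w (\<Union> (p ` I))) I"
      using p sets_into_space assms(1) by (intro has_sum_weight) blast+
    ultimately show ?thesis
      using has_sum_unique by blast
  qed
  interpret S: Dynkin_system \<Omega> ?S
  proof (rule Dynkin_systemI')
    \<comment> \<open>The empty family gives \<open>\<rho> {} = 0\<close>.\<close>
    show "{} \<in> ?S"
      using sum_UN[of "\<lambda>_. {}" "{}"] by (simp add: disjoint_family_on_def)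
    show "A \<subseteq> \<Omega>" if "A \<in> ?S" for A
      using that sets_into_space by blast
  next
    fix A assume "A \<in> ?S"
    moreover from this have "sum w (\<Omega> - A) = 1 - sum w A"
      using assms(1) total sets_into_space by (subst sum_diff) auto
    ultimately show "\<Omega> - A \<in> ?S"
      using state_compl[OF D \<rho>] by auto
  next
    fix A :: "nat \<Rightarrow> _" assume "disjoint_family A" "range A \<subseteq> ?S"
    then show "(\<Union>i. A i) \<in> ?S"
      using sum_UN[of A UNIV] by auto
  qed
  have "?D \<subseteq> ?S"
    using gen by (intro S.Dynkin_subset) auto
  then show ?thesis
    using A by auto
qed

section \<open>Single boxes\<close>

definition cylinder :: "nat \<Rightarrow> (nat \<Rightarrow> 'u set) \<Rightarrow> nat \<Rightarrow> 'u \<Rightarrow> (nat \<Rightarrow> 'u) set" where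
  "cylinder N U a \<alpha> = {x \<in> phase_space N U. x a = \<alpha>}"

definition cylinders :: "nat \<Rightarrow> (nat \<Rightarrow> 'u set) \<Rightarrow> (nat \<Rightarrow> 'u) set set" where
  "cylinders N U = {cylinder N U a \<alpha> | a \<alpha>. a \<in> {1..N} \<and> \<alpha> \<in> U a}"

abbreviation box_events :: "nat \<Rightarrow> (nat \<Rightarrow> 'u set) \<Rightarrow> (nat \<Rightarrow> 'u) set set" where
  "box_events N U \<equiv> Dynkin (phase_space N U) (cylinders N U)"

text \<open>Outcomes of different inputs are made independent, each following the distribution that
  \<open>\<mu>\<close> gives for its input. This picks one joint distribution with the prescribed
  marginals; \<open>\<mu>\<close> alone need not determine it.\<close>

definition outcome_weight ::
  "nat \<Rightarrow> (nat \<Rightarrow> 'u set) \<Rightarrow> ((nat \<Rightarrow> 'u) set \<Rightarrow> real) \<Rightarrow> (nat \<Rightarrow> 'u) \<Rightarrow> real" where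
  "outcome_weight N U \<mu> = (\<lambda>x. \<Prod>a\<in>{1..N}. \<mu> (cylinder N U a (x a)))"

lemma cylinders_subset: "cylinders N U \<subseteq> Pow (phase_space N U)"
  by (auto simp: cylinders_def cylinder_def)

lemmas Dynkin_system_box_events = Dynkin_system_Dynkin[OF cylinders_subset]

lemma single_box_logic_eq: "single_box_logic N U = set_logic (phase_space N U) (box_events N U)"
  using generated_logic_eq[OF cylinders_subset, of N U]
  by (simp add: single_box_logic_def cylinders_def cylinder_def)

lemma cylinder_in_box_events:
  "a \<in> {1..N} \<Longrightarrow> \<alpha> \<in> U a \<Longrightarrow> cylinder N U a \<alpha> \<in> box_events N U"
  by (rule Dynkin_Basic) (auto simp: cylinders_def)

lemma UN_cylinder: "a \<in> {1..N} \<Longrightarrow> (\<Union>\<alpha>\<in>U a. cylinder N U a \<alpha>) = phase_space N U"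
  by (fastforce simp: cylinder_def phase_space_def dest: PiE_mem)

lemma disjoint_cylinder: "disjoint_family_on (cylinder N U a) S"
  by (auto simp: disjoint_family_on_def cylinder_def)

locale box =
  fixes N :: nat and U :: "nat \<Rightarrow> 'u set"
  assumes inputs: "N \<ge> 1"
    and outcomes: "\<And>a. a \<in> {1..N} \<Longrightarrow> finite (U a)"
begin

lemma finite_phase_space: "finite (phase_space N U)"
  unfolding phase_space_def using outcomes by (intro finite_PiE) auto

text \<open>Supplies the partition into generators that \<open>vimage_in_Dynkin_system\<close> asks
  for.\<close>

lemma cylinder_partition:
  obtains C where "C \<subseteq> cylinders N U" "finite C" "disjoint C" "\<Union> C = phase_space N U"
proof
  \<comment> \<open>The cylinders of a single input partition the phase space; input 1 exists
    because \<open>N \<ge> 1\<close>.\<close>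
  show "cylinder N U 1 ` U 1 \<subseteq> cylinders N U"
    using inputs by (auto simp: cylinders_def)
  show "finite (cylinder N U 1 ` U 1)"
    using inputs outcomes[of 1] by auto
  show "disjoint (cylinder N U 1 ` U 1)"
    by (auto simp: disjoint_def cylinder_def)
  show "\<Union> (cylinder N U 1 ` U 1) = phase_space N U"
    using inputs by (intro UN_cylinder) auto
qed

section \<open>The product measure extending a state\<close>

context
  fixes \<mu> assumes \<mu>: "\<mu> \<in> states (single_box_logic N U)"
begin

lemma state_cylinder_nonneg: "a \<in> {1..N} \<Longrightarrow> \<alpha> \<in> U a \<Longrightarrow> 0 \<le> \<mu> (cylinder N U a \<alpha>)"
  using \<mu> cylinder_in_box_events[of a N \<alpha> U]
  by (auto simp: single_box_logic_eq states_set_logic[OF Dynkin_system_box_events])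

text \<open>The cylinders of one input partition the phase space, so additivity makes their values a
  probability distribution on \<open>U a\<close>.\<close>

lemma sum_state_cylinder:
  assumes a: "a \<in> {1..N}"
  shows "(\<Sum>\<alpha>\<in>U a. \<mu> (cylinder N U a \<alpha>)) = 1"
proof -
  have "\<mu> (\<Union>\<alpha>\<in>U a. cylinder N U a \<alpha>) = (\<Sum>\<alpha>\<in>U a. \<mu> (cylinder N U a \<alpha>))"
    using \<mu> a outcomes[OF a] cylinder_in_box_events disjoint_cylinder
    unfolding single_box_logic_eq by (intro state_UN_finite[OF Dynkin_system_box_events])
  moreover have "\<mu> (phase_space N U) = 1"
    using \<mu> by (simp add: single_box_logic_eq states_set_logic[OF Dynkin_system_box_events])
  ultimately show ?thesis
    using a by (simp add: UN_cylinder)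
qed

lemma outcome_weight_nonneg: "x \<in> phase_space N U \<Longrightarrow> 0 \<le> outcome_weight N U \<mu> x"
  unfolding outcome_weight_def phase_space_def
  by (intro prod_nonneg ballI state_cylinder_nonneg) auto

text \<open>A sum of products over a product set is the product of the sums, and here each factor is
  1.\<close>

lemma sum_outcome_weight: "sum (outcome_weight N U \<mu>) (phase_space N U) = 1"
proof -
  have "sum (outcome_weight N U \<mu>) (phase_space N U)
      = (\<Prod>a\<in>{1..N}. \<Sum>\<alpha>\<in>U a. \<mu> (cylinder N U a \<alpha>))"
    unfolding phase_space_def outcome_weight_def using outcomes by (intro prod_sum_PiE[symmetric]) auto
  then show ?thesis
    by (simp add: sum_state_cylinder)
qed

lemma sum_outcome_weight_cylinder:
  assumes a: "a \<in> {1..N}" and \<alpha>: "\<alpha> \<in> U a"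
  shows "sum (outcome_weight N U \<mu>) (cylinder N U a \<alpha>) = \<mu> (cylinder N U a \<alpha>)"
proof -
  \<comment> \<open>The cylinder is again a product set, with the outcome set at \<open>a\<close>
    shrunk to one point, so sum and product can be exchanged as before. All factors other than the
    one at \<open>a\<close> equal 1.\<close>
  let ?U = "U(a := {\<alpha>})"
  have eq: "cylinder N U a \<alpha> = (\<Pi>\<^sub>E c\<in>{1..N}. ?U c)"
    using a \<alpha> unfolding cylinder_def phase_space_def PiE_iff extensional_def
    by (auto split: if_splits)
  have "sum (outcome_weight N U \<mu>) (cylinder N U a \<alpha>)
      = (\<Prod>c\<in>{1..N}. \<Sum>\<gamma>\<in>?U c. \<mu> (cylinder N U c \<gamma>))"
    unfolding outcome_weight_def eq using outcomes by (intro prod_sum_PiE[symmetric]) auto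
  also have "\<dots> = (\<Prod>c\<in>{1..N}. if c = a then \<mu> (cylinder N U a \<alpha>) else 1)"
    by (rule prod.cong) (auto simp: sum_state_cylinder)
  also have "\<dots> = \<mu> (cylinder N U a \<alpha>)"
    using a by (simp add: prod.delta)
  finally show ?thesis .
qed

text \<open>Agreement on the cylinders is enough, since they generate the logic.\<close>

lemma sum_outcome_weight_event:
  assumes "A \<in> box_events N U"
  shows "sum (outcome_weight N U \<mu>) A = \<mu> A"
proof (rule state_eq_weight[OF finite_phase_space cylinders_subset _ sum_outcome_weight _ assms])
  show "\<mu> \<in> states (set_logic (phase_space N U) (box_events N U))"
    using \<mu> by (simp add: single_box_logic_eq)
  show "sum (outcome_weight N U \<mu>) a = \<mu> a" if "a \<in> cylinders N U" for a
    using that sum_outcome_weight_cylinder by (auto simp: cylinders_def)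
qed

end

section \<open>Point masses on a single box\<close>

text \<open>The deterministic state in which every input \<open>a\<close> yields the outcome
  \<open>x a\<close>.\<close>

definition point_state :: "(nat \<Rightarrow> 'u) \<Rightarrow> (nat \<Rightarrow> 'u) set \<Rightarrow> real" where
  "point_state x = weight_state (box_events N U) (\<lambda>z. if z = x then 1 else 0)"

lemma point_state_in_states:
  assumes "x \<in> phase_space N U"
  shows "point_state x \<in> states (single_box_logic N U)"
  unfolding point_state_def single_box_logic_eq using assms finite_phase_space
  by (intro weight_state_in_states Dynkin_system_box_events) auto

text \<open>The marginals of a point mass are point masses, and their product is the original point
  mass again. Richness rests on this.\<close>

lemma outcome_weight_point_state:
  assumes x: "x \<in> phase_space N U" and z: "z \<in> phase_space N U"
  shows "outcome_weight N U (point_state x) z = (if z = x then 1 else 0)"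
proof -
  have "point_state x (cylinder N U a (z a)) = (if z a = x a then 1 else 0)" if "a \<in> {1..N}" for a
  proof -
    have "z a \<in> U a"
      using z that by (auto simp: phase_space_def)
    moreover have "finite (cylinder N U a (z a))"
      using finite_phase_space by (simp add: cylinder_def)
    ultimately show ?thesis
      using x that cylinder_in_box_events[of a N "z a" U]
      by (auto simp: point_state_def weight_state_def cylinder_def)
  qed
  then have "outcome_weight N U (point_state x) z = (\<Prod>a\<in>{1..N}. if z a = x a then 1 else 0)"
    by (simp add: outcome_weight_def)
  \<comment> \<open>Both functions are extensional on \<open>{1..N}\<close>, so if they differ then
    they differ at some input, where the factor vanishes.\<close>
  moreover have "\<exists>a\<in>{1..N}. z a \<noteq> x a" if "z \<noteq> x"
    using that PiE_ext[of z "{1..N}" U x] x z by (auto simp: phase_space_def)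
  ultimately show ?thesis
    by (auto intro!: prod_zero)
qed

end

section \<open>The box world\<close>

definition rectangles ::
  "nat \<Rightarrow> (nat \<Rightarrow> 'u set) \<Rightarrow> nat \<Rightarrow> (nat \<Rightarrow> 'v set) \<Rightarrow> ((nat \<Rightarrow> 'u) \<times> (nat \<Rightarrow> 'v)) set set" where
  "rectangles N U M V = {A \<times> B | A B. A \<in> cylinders N U \<and> B \<in> cylinders M V}"

abbreviation box_world_events ::
  "nat \<Rightarrow> (nat \<Rightarrow> 'u set) \<Rightarrow> nat \<Rightarrow> (nat \<Rightarrow> 'v set) \<Rightarrow> ((nat \<Rightarrow> 'u) \<times> (nat \<Rightarrow> 'v)) set set" where
  "box_world_events N U M V \<equiv> Dynkin (phase_space N U \<times> phase_space M V) (rectangles N U M V)"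

lemma rectangles_subset: "rectangles N U M V \<subseteq> Pow (phase_space N U \<times> phase_space M V)"
  using cylinders_subset[of N U] cylinders_subset[of M V] by (fastforce simp: rectangles_def)

lemmas Dynkin_system_box_world_events = Dynkin_system_Dynkin[OF rectangles_subset]

lemma box_world_events_subset:
  "box_world_events N U M V \<subseteq> Pow (phase_space N U \<times> phase_space M V)"
  using Dynkin_system_box_world_events[of N U M V]
  by (simp add: Dynkin_system_def subset_class_def)

lemma box_world_logic_eq:
  "box_world_logic N U M V =
    set_logic (phase_space N U \<times> phase_space M V) (box_world_events N U M V)"
proof -
  have eq: "{(x, y) \<in> phase_space N U \<times> phase_space M V. x a = \<alpha> \<and> y b = \<beta>}
      = cylinder N U a \<alpha> \<times> cylinder M V b \<beta>" for a \<alpha> b \<beta>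
    by (auto simp: cylinder_def)
  have "{cylinder N U a \<alpha> \<times> cylinder M V b \<beta> | a \<alpha> b \<beta>.
      a \<in> {1..N} \<and> \<alpha> \<in> U a \<and> b \<in> {1..M} \<and> \<beta> \<in> V b} = rectangles N U M V"
    unfolding rectangles_def cylinders_def by blast
  then show ?thesis
    unfolding box_world_logic_def eq using generated_logic_eq[OF rectangles_subset] by metis
qed

locale two_boxes = fst: box N U + snd: box M V
  for N M :: nat and U :: "nat \<Rightarrow> 'u set" and V :: "nat \<Rightarrow> 'v set"
begin

text \<open>This makes the Cartesian product a map into the box world logic. Products of cylinders
  are generators, and each factor then extends through its Dynkin hull.\<close>

lemma Times_in_box_world_events:
  assumes "A \<in> box_events N U" and "B \<in> box_events M V"
  shows "A \<times> B \<in> box_world_events N U M V"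
proof -
  obtain C C' where
    C: "C \<subseteq> cylinders N U" "finite C" "disjoint C" "\<Union> C = phase_space N U" and
    C': "C' \<subseteq> cylinders M V" "finite C'" "disjoint C'" "\<Union> C' = phase_space M V"
    using fst.cylinder_partition snd.cylinder_partition by metis
  show ?thesis
    by (rule Times_in_Dynkin_system[OF Dynkin_system_box_world_events
          cylinders_subset C cylinders_subset C' _ assms])
      (auto simp: rectangles_def)
qed

section \<open>Product states\<close>

text \<open>As members of the box world logic need not be rectangles, \<open>\<mu>\<close> and
  \<open>\<nu>\<close> are first turned into weights of points, whose products are then summed over
  the event.\<close>

definition product_state ::
  "((nat \<Rightarrow> 'u) set \<Rightarrow> real) \<Rightarrow> ((nat \<Rightarrow> 'v) set \<Rightarrow> real) \<Rightarrow>
   ((nat \<Rightarrow> 'u) \<times> (nat \<Rightarrow> 'v)) set \<Rightarrow> real" where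
  "product_state \<mu> \<nu> = weight_state (box_world_events N U M V)
     (\<lambda>(x, y). outcome_weight N U \<mu> x * outcome_weight M V \<nu> y)"

lemma sum_Times:
  fixes f :: "(nat \<Rightarrow> 'u) \<Rightarrow> real" and g :: "(nat \<Rightarrow> 'v) \<Rightarrow> real"
  shows "(\<Sum>(x, y)\<in>A \<times> B. f x * g y) = sum f A * sum g B"
  by (simp add: sum_product sum.cartesian_product)

lemma product_state_in_states:
  assumes "\<mu> \<in> states (single_box_logic N U)" and "\<nu> \<in> states (single_box_logic M V)"
  shows "product_state \<mu> \<nu> \<in> states (box_world_logic N U M V)"
  unfolding product_state_def box_world_logic_eq
  using assms fst.finite_phase_space snd.finite_phase_space
  by (intro weight_state_in_states Dynkin_system_box_world_events)
    (auto simp: sum_Times fst.sum_outcome_weight snd.sum_outcome_weight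
        fst.outcome_weight_nonneg snd.outcome_weight_nonneg)

text \<open>The sum over a rectangle factorizes, and each factor is the value of a state, because
  the weight reproduces the state on all its events.\<close>

lemma product_state_Times:
  assumes "\<mu> \<in> states (single_box_logic N U)" and "\<nu> \<in> states (single_box_logic M V)"
    and "A \<in> box_events N U" and "B \<in> box_events M V"
  shows "product_state \<mu> \<nu> (A \<times> B) = \<mu> A * \<nu> B"
  using assms Times_in_box_world_events
  by (simp add: product_state_def weight_state_def sum_Times
      fst.sum_outcome_weight_event snd.sum_outcome_weight_event)

text \<open>Both weights are point masses here, so only a summand at \<open>(x, y)\<close> can
  survive.\<close>

lemma product_state_point_state:
  assumes x: "x \<in> phase_space N U" and y: "y \<in> phase_space M V"
    and A: "A \<in> box_world_events N U M V"
  shows "product_state (fst.point_state x) (snd.point_state y) A = (if (x, y) \<in> A then 1 else 0)"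
proof -
  have sub: "A \<subseteq> phase_space N U \<times> phase_space M V"
    using box_world_events_subset A by blast
  then have "finite A"
    using fst.finite_phase_space snd.finite_phase_space finite_subset by blast
  have "product_state (fst.point_state x) (snd.point_state y) A
      = (\<Sum>(x', y')\<in>A. outcome_weight N U (fst.point_state x) x' * outcome_weight M V (snd.point_state y) y')"
    using A by (simp add: product_state_def weight_state_def)
  also have "\<dots> = (\<Sum>z\<in>A. if z = (x, y) then 1 else 0)"
  proof (intro sum.cong refl)
    fix z assume "z \<in> A"
    then have "fst z \<in> phase_space N U" "snd z \<in> phase_space M V"
      using sub by auto
    then show "(case z of (x', y') \<Rightarrow> outcome_weight N U (fst.point_state x) x' *
        outcome_weight M V (snd.point_state y) y') = (if z = (x, y) then 1 else 0)"
      using x y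
      by (cases z) (simp add: fst.outcome_weight_point_state snd.outcome_weight_point_state)
  qed
  finally show ?thesis
    using \<open>finite A\<close> by simp
qed

section \<open>Richness and generation\<close>

text \<open>A point of \<open>A\<close> outside \<open>B\<close> would give a product of point
  masses that is 1 on \<open>A\<close> and 0 on \<open>B\<close>.\<close>

lemma rich_product_states:
  "rich (box_world_logic N U M V)
    (case_prod product_state ` (states (single_box_logic N U) \<times> states (single_box_logic M V)))"
  (is "rich ?L ?R")
  unfolding rich_def
proof (intro conjI ballI impI)
  show "?R \<subseteq> states ?L"
    using product_state_in_states by auto
next
  fix A B assume AB: "A \<in> carrier ?L" "B \<in> carrier ?L"
    and incl: "{\<mu> \<in> ?R. \<mu> A = 1} \<subseteq> {\<mu> \<in> ?R. \<mu> B = 1}"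
  have "z \<in> B" if zA: "z \<in> A" for z
  proof -
    have "z \<in> phase_space N U \<times> phase_space M V"
      using zA AB(1) box_world_events_subset[of N U M V] by (auto simp: box_world_logic_eq)
    then obtain x y where z: "z = (x, y)" and xy: "x \<in> phase_space N U" "y \<in> phase_space M V"
      by blast
    let ?\<rho> = "product_state (fst.point_state x) (snd.point_state y)"
    have "?\<rho> \<in> ?R"
      using xy fst.point_state_in_states snd.point_state_in_states by force
    moreover have "?\<rho> A = 1"
      using that z AB(1) xy by (simp add: product_state_point_state box_world_logic_eq)
    ultimately have "?\<rho> B = 1"
      using incl by blast
    then show ?thesis
      using z AB(2) xy by (simp add: product_state_point_state box_world_logic_eq split: if_splits)
  qed
  then show "A \<sqsubseteq>\<^bsub>?L\<^esub> B"
    by (auto simp: box_world_logic_eq)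
qed

text \<open>The products of events include the generating rectangles and all lie in the box world
  logic, so the two Dynkin hulls contain each other.\<close>

lemma generated_by_products:
  "generated_sublogic (box_world_logic N U M V)
    (case_prod (\<times>) ` (box_events N U \<times> box_events M V)) = box_world_events N U M V"
  (is "generated_sublogic _ ?P = ?D")
proof -
  have P: "?P \<subseteq> ?D"
    using Times_in_box_world_events by auto
  interpret D: Dynkin_system "phase_space N U \<times> phase_space M V" ?D
    by (rule Dynkin_system_box_world_events)
  have "rectangles N U M V \<subseteq> ?P"
    by (auto simp: rectangles_def)
  then have "?D \<subseteq> Dynkin (phase_space N U \<times> phase_space M V) ?P"
    by (auto simp: Dynkin_def)
  moreover have "Dynkin (phase_space N U \<times> phase_space M V) ?P \<subseteq> ?D"
    using P by (rule D.Dynkin_subset)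
  ultimately show ?thesis
    unfolding box_world_logic_eq
      generated_sublogic_set_logic[OF Dynkin_system_box_world_events P]
    by (intro equalityI)
qed

lemma strong_tensor_product_box_world:
  "strong_tensor_product
    (box_world_logic N U M V) (states (box_world_logic N U M V))
    (single_box_logic N U) (states (single_box_logic N U))
    (single_box_logic M V) (states (single_box_logic M V))"
  unfolding strong_tensor_product_def
proof (intro conjI exI[of _ "case_prod (\<times>)"] exI[of _ "case_prod product_state"])
  show "quantum_logic (single_box_logic N U)" "quantum_logic (single_box_logic M V)"
    "quantum_logic (box_world_logic N U M V)"
    by (simp_all add: single_box_logic_eq box_world_logic_eq quantum_logic_set_logic
        Dynkin_system_box_events Dynkin_system_box_world_events)
qed (use Times_in_box_world_events product_state_in_states product_state_Times
    rich_product_states generated_by_products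
    in \<open>auto simp: single_box_logic_eq box_world_logic_eq\<close>)

end

theorem theorem15:
  fixes N M :: nat and U :: "nat \<Rightarrow> 'u set" and V :: "nat \<Rightarrow> 'v set"
  assumes "N \<ge> 1" and "M \<ge> 1"
    and "\<And>a. a \<in> {1..N} \<Longrightarrow> finite (U a) \<and> U a \<noteq> {}"
    and "\<And>b. b \<in> {1..M} \<Longrightarrow> finite (V b) \<and> V b \<noteq> {}"
  shows "strong_tensor_product
    (box_world_logic N U M V) (states (box_world_logic N U M V))
    (single_box_logic N U) (states (single_box_logic N U))
    (single_box_logic M V) (states (single_box_logic M V))"
proof -
  interpret two_boxes N M U V
    using assms by unfold_locales auto
  show ?thesis
    by (rule strong_tensor_product_box_world)
qed

end
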